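(* Let $L$ be either of the sequent calculi $\mathrm{lTS4}$ or $\mathrm{gTS4}$ defined in the context. Then the rules ($\neg$left$^{-1}$) $\Gamma\Rightarrow\Delta,\neg\alpha$ / $\alpha,\Gamma\Rightarrow\Delta$ and ($\neg$right$^{-1}$) $\neg\alpha,\Gamma\Rightarrow\Delta$ / $\Gamma\Rightarrow\Delta,\alpha$ are admissible in cut-free $L$.
   Context: Formulas are built from countably many propositional variables using the binary connectives $\wedge,\vee,\to$ and the unary connectives $\neg,\Box,\Diamond$. Letters $\Gamma,\Delta$ (possibly with subscripts) denote finite, possibly empty, sets of formulas; a sequent is an expression $\Gamma\Rightarrow\Delta$; a comma denotes union. For a word $w$ over $\{\neg,\Box,\Diamond\}$, $w\Gamma=\{w\gamma:\gamma\in\Gamma\}$. A rule "$S_1;\dots;S_n\,/\,S$" has premises $S_1,\dots,S_n$ and conclusion $S$. "Cut-free $L$" means the system $L$ with the rule (cut) removed. A rule $R$ is admissible in a calculus $M$ if for every instance of $R$ with premises $S_1,\dots,S_n$ and conclusion $S$, whenever every $S_i$ is provable in $M$, $S$ is provable in $M$. The calculus lTS4. Initial sequents: for every propositional variable $p$: $p\Rightarrow p$, $\neg p\Rightarrow\neg p$, $\neg p,p\Rightarrow$, and $\Rightarrow\neg p,p$. Structural rules: (cut) $\Gamma\Rightarrow\alpha$; $\alpha,\Gamma\Rightarrow\Delta$ / $\Gamma\Rightarrow\Delta$. (we-left) $\Gamma\Rightarrow\Delta$ / $\alpha,\Gamma\Rightarrow\Delta$. (we-right) $\Gamma\Rightarrow\Delta$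 / $\Gamma\Rightarrow\Delta,\alpha$. Non-twist logical rules: ($\wedge$left) $\alpha,\beta,\Gamma\Rightarrow\Delta$ / $\alpha\wedge\beta,\Gamma\Rightarrow\Delta$. ($\wedge$right) $\Gamma\Rightarrow\Delta,\alpha$; $\Gamma\Rightarrow\Delta,\beta$ / $\Gamma\Rightarrow\Delta,\alpha\wedge\beta$. ($\vee$left) $\alpha,\Gamma\Rightarrow\Delta$; $\beta,\Gamma\Rightarrow\Delta$ / $\alpha\vee\beta,\Gamma\Rightarrow\Delta$. ($\vee$right) $\Gamma\Rightarrow\Delta,\alpha,\beta$ / $\Gamma\Rightarrow\Delta,\alpha\vee\beta$. ($\to$left) $\Gamma\Rightarrow\Delta,\alpha$; $\beta,\Gamma\Rightarrow\Delta$ / $\alpha\to\beta,\Gamma\Rightarrow\Delta$. ($\to$right) $\alpha,\Gamma\Rightarrow\Delta,\beta$ / $\Gamma\Rightarrow\Delta,\alpha\to\beta$. ($\Box$left) $\alpha,\Gamma\Rightarrow\Delta$ / $\Box\alpha,\Gamma\Rightarrow\Delta$. ($\Box$right) $\Box\Gamma_1,\neg\Diamond\Gamma_2\Rightarrow\Diamond\Delta_1,\neg\Box\Delta_2,\alpha$ / $\Box\Gamma_1,\neg\Diamond\Gamma_2\Rightarrow\Diamond\Delta_1,\neg\Box\Delta_2,\Box\alpha$. ($\Diamond$left) $\alpha,\Box\Gamma_1,\neg\Diamond\Gamma_2\Rightarrow\Diamond\Delta_1,\neg\Box\Delta_2$ / $\Diamond\alpha,\Box\Gamma_1,\neg\Diamond\Gamma_2\Rightarrow\Diamond\Delta_1,\neg\Box\Delta_2$.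 ($\Diamond$right) $\Gamma\Rightarrow\Delta,\alpha$ / $\Gamma\Rightarrow\Delta,\Diamond\alpha$. Twist rules: ($\neg\neg$left$^t$) $\alpha,\Gamma\Rightarrow\Delta$ / $\neg\neg\alpha,\Gamma\Rightarrow\Delta$. ($\neg\neg$right$^t$) $\Gamma\Rightarrow\Delta,\alpha$ / $\Gamma\Rightarrow\Delta,\neg\neg\alpha$. ($\neg\wedge$left$^t$) $\Gamma\Rightarrow\Delta,\alpha$; $\Gamma\Rightarrow\Delta,\beta$ / $\neg(\alpha\wedge\beta),\Gamma\Rightarrow\Delta$. ($\neg\wedge$right$^t$) $\alpha,\beta,\Gamma\Rightarrow\Delta$ / $\Gamma\Rightarrow\Delta,\neg(\alpha\wedge\beta)$. ($\neg\vee$left$^t$) $\Gamma\Rightarrow\Delta,\alpha,\beta$ / $\neg(\alpha\vee\beta),\Gamma\Rightarrow\Delta$. ($\neg\vee$right$^t$) $\alpha,\Gamma\Rightarrow\Delta$; $\beta,\Gamma\Rightarrow\Delta$ / $\Gamma\Rightarrow\Delta,\neg(\alpha\vee\beta)$. ($\neg\to$left$^t$) $\alpha,\Gamma\Rightarrow\Delta,\beta$ / $\neg(\alpha\to\beta),\Gamma\Rightarrow\Delta$. ($\neg\to$right$^t$) $\Gamma\Rightarrow\Delta,\alpha$; $\beta,\Gamma\Rightarrow\Delta$ / $\Gamma\Rightarrow\Delta,\neg(\alpha\to\beta)$. ($\neg\Box$left$^t$) $\Box\Gamma_1,\neg\Diamond\Gamma_2\Rightarrow\Diamond\Delta_1,\neg\Box\Delta_2,\alpha$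 / $\neg\Box\alpha,\Box\Gamma_1,\neg\Diamond\Gamma_2\Rightarrow\Diamond\Delta_1,\neg\Box\Delta_2$. ($\neg\Box$right$^t$) $\alpha,\Gamma\Rightarrow\Delta$ / $\Gamma\Rightarrow\Delta,\neg\Box\alpha$. ($\neg\Diamond$left$^t$) $\Gamma\Rightarrow\Delta,\alpha$ / $\neg\Diamond\alpha,\Gamma\Rightarrow\Delta$. ($\neg\Diamond$right$^t$) $\alpha,\Box\Gamma_1,\neg\Diamond\Gamma_2\Rightarrow\Diamond\Delta_1,\neg\Box\Delta_2$ / $\Box\Gamma_1,\neg\Diamond\Gamma_2\Rightarrow\Diamond\Delta_1,\neg\Box\Delta_2,\neg\Diamond\alpha$. The calculus gTS4 is obtained from lTS4 by replacing ($\Box$right), ($\Diamond$left), ($\neg\Box$left$^t$), ($\neg\Diamond$right$^t$) with: ($\Box$right$^T$) $\Box\Gamma_1,\Box\Delta_2\Rightarrow\Diamond\Delta_1,\Diamond\Gamma_2,\alpha$ / $\Box\Gamma_1,\neg\Diamond\Gamma_2\Rightarrow\Diamond\Delta_1,\neg\Box\Delta_2,\Box\alpha$. ($\Diamond$left$^T$) $\alpha,\Box\Gamma_1,\Box\Delta_2\Rightarrow\Diamond\Delta_1,\Diamond\Gamma_2$ / $\Diamond\alpha,\Box\Gamma_1,\neg\Diamond\Gamma_2\Rightarrow\Diamond\Delta_1,\neg\Box\Delta_2$. ($\neg\Box$left$^T$) $\Box\Gamma_1,\Box\Delta_2\Rightarrow\Diamond\Delta_1,\Diamond\Gamma_2,\alpha$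 / $\neg\Box\alpha,\Box\Gamma_1,\neg\Diamond\Gamma_2\Rightarrow\Diamond\Delta_1,\neg\Box\Delta_2$. ($\neg\Diamond$right$^T$) $\alpha,\Box\Gamma_1,\Box\Delta_2\Rightarrow\Diamond\Delta_1,\Diamond\Gamma_2$ / $\Box\Gamma_1,\neg\Diamond\Gamma_2\Rightarrow\Diamond\Delta_1,\neg\Box\Delta_2,\neg\Diamond\alpha$. (All other rules and initial sequents of lTS4, including ($\neg\Diamond$left$^t$), are kept.) *)

theory Defs
  imports Main "HOL-Library.FSet"
begin

datatype fm =
    Var nat
  | And fm fm  (infixr "\<^bold>\<and>" 75)
  | Or fm fm   (infixr "\<^bold>\<or>" 74)
  | Imp fm fm  (infixr "\<^bold>\<rightarrow>" 73)
  | Neg fm     ("\<^bold>\<not>_" [80] 80)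
  | Box fm     ("\<box>_" [80] 80)
  | Dia fm     ("\<diamond>_" [80] 80)

datatype sequent = Sequent "fm fset" "fm fset"  (infix "\<Rrightarrow>" 50)

inductive initial :: "sequent \<Rightarrow> bool" where
  "initial ({|Var p|} \<Rrightarrow> {|Var p|})"
| "initial ({|\<^bold>\<not>Var p|} \<Rrightarrow> {|\<^bold>\<not>Var p|})"
| "initial ({|\<^bold>\<not>Var p, Var p|} \<Rrightarrow> {||})"
| "initial ({||} \<Rrightarrow> {|\<^bold>\<not>Var p, Var p|})"

text \<open>
  Rules are referred to by name, so that a calculus is a set of names and a rule can be removed
  from it. The suffix \<open>T\<close> marks the four modal rules that are specific to gTS4.
\<close>

datatype rule_name =
    Cut | WeL | WeR | AndL | AndR | OrL
  | OrR | ImpL | ImpR | BoxL | BoxR | DiaL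
  | DiaR | NegNegL | NegNegR | NegAndL | NegAndR | NegOrL
  | NegOrR | NegImpL | NegImpR | NegBoxL | NegBoxR | NegDiaL
  | NegDiaR | BoxRT | DiaLT | NegBoxLT | NegDiaRT

text \<open>
  \<open>rule_inst r Ps S\<close>: the sequents \<open>Ps\<close> over \<open>S\<close> form an instance of the rule named \<open>r\<close>.
  As sequents consist of sets, an active formula may also occur in the context.
\<close>

inductive rule_inst :: "rule_name \<Rightarrow> sequent list \<Rightarrow> sequent \<Rightarrow> bool" where
  "rule_inst Cut
     [\<Gamma> \<Rrightarrow> {|\<alpha>|},
      finsert \<alpha> \<Gamma> \<Rrightarrow> \<Delta>]
     (\<Gamma> \<Rrightarrow> \<Delta>)"
| "rule_inst WeL
     [\<Gamma> \<Rrightarrow> \<Delta>]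
     (finsert \<alpha> \<Gamma> \<Rrightarrow> \<Delta>)"
| "rule_inst WeR
     [\<Gamma> \<Rrightarrow> \<Delta>]
     (\<Gamma> \<Rrightarrow> finsert \<alpha> \<Delta>)"
| "rule_inst AndL
     [finsert \<alpha> (finsert \<beta> \<Gamma>) \<Rrightarrow> \<Delta>]
     (finsert (\<alpha> \<^bold>\<and> \<beta>) \<Gamma> \<Rrightarrow> \<Delta>)"
| "rule_inst AndR
     [\<Gamma> \<Rrightarrow> finsert \<alpha> \<Delta>,
      \<Gamma> \<Rrightarrow> finsert \<beta> \<Delta>]
     (\<Gamma> \<Rrightarrow> finsert (\<alpha> \<^bold>\<and> \<beta>) \<Delta>)"
| "rule_inst OrL
     [finsert \<alpha> \<Gamma> \<Rrightarrow> \<Delta>,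
      finsert \<beta> \<Gamma> \<Rrightarrow> \<Delta>]
     (finsert (\<alpha> \<^bold>\<or> \<beta>) \<Gamma> \<Rrightarrow> \<Delta>)"
| "rule_inst OrR
     [\<Gamma> \<Rrightarrow> finsert \<alpha> (finsert \<beta> \<Delta>)]
     (\<Gamma> \<Rrightarrow> finsert (\<alpha> \<^bold>\<or> \<beta>) \<Delta>)"
| "rule_inst ImpL
     [\<Gamma> \<Rrightarrow> finsert \<alpha> \<Delta>,
      finsert \<beta> \<Gamma> \<Rrightarrow> \<Delta>]
     (finsert (\<alpha> \<^bold>\<rightarrow> \<beta>) \<Gamma> \<Rrightarrow> \<Delta>)"
| "rule_inst ImpR
     [finsert \<alpha> \<Gamma> \<Rrightarrow> finsert \<beta> \<Delta>]
     (\<Gamma> \<Rrightarrow> finsert (\<alpha> \<^bold>\<rightarrow> \<beta>) \<Delta>)"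
| "rule_inst BoxL
     [finsert \<alpha> \<Gamma> \<Rrightarrow> \<Delta>]
     (finsert (\<box>\<alpha>) \<Gamma> \<Rrightarrow> \<Delta>)"
| "rule_inst BoxR
     [Box |`| \<Gamma>\<^sub>1 |\<union>| Neg |`| Dia |`| \<Gamma>\<^sub>2 \<Rrightarrow> finsert \<alpha> (Dia |`| \<Delta>\<^sub>1 |\<union>| Neg |`| Box |`| \<Delta>\<^sub>2)]
     (Box |`| \<Gamma>\<^sub>1 |\<union>| Neg |`| Dia |`| \<Gamma>\<^sub>2 \<Rrightarrow> finsert (\<box>\<alpha>) (Dia |`| \<Delta>\<^sub>1 |\<union>| Neg |`| Box |`| \<Delta>\<^sub>2))"
| "rule_inst DiaL
     [finsert \<alpha> (Box |`| \<Gamma>\<^sub>1 |\<union>| Neg |`| Dia |`| \<Gamma>\<^sub>2) \<Rrightarrow> Dia |`| \<Delta>\<^sub>1 |\<union>| Neg |`| Box |`| \<Delta>\<^sub>2]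
     (finsert (\<diamond>\<alpha>) (Box |`| \<Gamma>\<^sub>1 |\<union>| Neg |`| Dia |`| \<Gamma>\<^sub>2) \<Rrightarrow> Dia |`| \<Delta>\<^sub>1 |\<union>| Neg |`| Box |`| \<Delta>\<^sub>2)"
| "rule_inst DiaR
     [\<Gamma> \<Rrightarrow> finsert \<alpha> \<Delta>]
     (\<Gamma> \<Rrightarrow> finsert (\<diamond>\<alpha>) \<Delta>)"
| "rule_inst NegNegL
     [finsert \<alpha> \<Gamma> \<Rrightarrow> \<Delta>]
     (finsert (\<^bold>\<not>\<^bold>\<not>\<alpha>) \<Gamma> \<Rrightarrow> \<Delta>)"
| "rule_inst NegNegR
     [\<Gamma> \<Rrightarrow> finsert \<alpha> \<Delta>]
     (\<Gamma> \<Rrightarrow> finsert (\<^bold>\<not>\<^bold>\<not>\<alpha>) \<Delta>)"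
| "rule_inst NegAndL
     [\<Gamma> \<Rrightarrow> finsert \<alpha> \<Delta>,
      \<Gamma> \<Rrightarrow> finsert \<beta> \<Delta>]
     (finsert (\<^bold>\<not>(\<alpha> \<^bold>\<and> \<beta>)) \<Gamma> \<Rrightarrow> \<Delta>)"
| "rule_inst NegAndR
     [finsert \<alpha> (finsert \<beta> \<Gamma>) \<Rrightarrow> \<Delta>]
     (\<Gamma> \<Rrightarrow> finsert (\<^bold>\<not>(\<alpha> \<^bold>\<and> \<beta>)) \<Delta>)"
| "rule_inst NegOrL
     [\<Gamma> \<Rrightarrow> finsert \<alpha> (finsert \<beta> \<Delta>)]
     (finsert (\<^bold>\<not>(\<alpha> \<^bold>\<or> \<beta>)) \<Gamma> \<Rrightarrow> \<Delta>)"
| "rule_inst NegOrR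
     [finsert \<alpha> \<Gamma> \<Rrightarrow> \<Delta>,
      finsert \<beta> \<Gamma> \<Rrightarrow> \<Delta>]
     (\<Gamma> \<Rrightarrow> finsert (\<^bold>\<not>(\<alpha> \<^bold>\<or> \<beta>)) \<Delta>)"
| "rule_inst NegImpL
     [finsert \<alpha> \<Gamma> \<Rrightarrow> finsert \<beta> \<Delta>]
     (finsert (\<^bold>\<not>(\<alpha> \<^bold>\<rightarrow> \<beta>)) \<Gamma> \<Rrightarrow> \<Delta>)"
| "rule_inst NegImpR
     [\<Gamma> \<Rrightarrow> finsert \<alpha> \<Delta>,
      finsert \<beta> \<Gamma> \<Rrightarrow> \<Delta>]
     (\<Gamma> \<Rrightarrow> finsert (\<^bold>\<not>(\<alpha> \<^bold>\<rightarrow> \<beta>)) \<Delta>)"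
| "rule_inst NegBoxL
     [Box |`| \<Gamma>\<^sub>1 |\<union>| Neg |`| Dia |`| \<Gamma>\<^sub>2 \<Rrightarrow> finsert \<alpha> (Dia |`| \<Delta>\<^sub>1 |\<union>| Neg |`| Box |`| \<Delta>\<^sub>2)]
     (finsert (\<^bold>\<not>\<box>\<alpha>) (Box |`| \<Gamma>\<^sub>1 |\<union>| Neg |`| Dia |`| \<Gamma>\<^sub>2) \<Rrightarrow> Dia |`| \<Delta>\<^sub>1 |\<union>| Neg |`| Box |`| \<Delta>\<^sub>2)"
| "rule_inst NegBoxR
     [finsert \<alpha> \<Gamma> \<Rrightarrow> \<Delta>]
     (\<Gamma> \<Rrightarrow> finsert (\<^bold>\<not>\<box>\<alpha>) \<Delta>)"
| "rule_inst NegDiaL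
     [\<Gamma> \<Rrightarrow> finsert \<alpha> \<Delta>]
     (finsert (\<^bold>\<not>\<diamond>\<alpha>) \<Gamma> \<Rrightarrow> \<Delta>)"
| "rule_inst NegDiaR
     [finsert \<alpha> (Box |`| \<Gamma>\<^sub>1 |\<union>| Neg |`| Dia |`| \<Gamma>\<^sub>2) \<Rrightarrow> Dia |`| \<Delta>\<^sub>1 |\<union>| Neg |`| Box |`| \<Delta>\<^sub>2]
     (Box |`| \<Gamma>\<^sub>1 |\<union>| Neg |`| Dia |`| \<Gamma>\<^sub>2 \<Rrightarrow> finsert (\<^bold>\<not>\<diamond>\<alpha>) (Dia |`| \<Delta>\<^sub>1 |\<union>| Neg |`| Box |`| \<Delta>\<^sub>2))"
| "rule_inst BoxRT
     [Box |`| \<Gamma>\<^sub>1 |\<union>| Box |`| \<Delta>\<^sub>2 \<Rrightarrow> finsert \<alpha> (Dia |`| \<Delta>\<^sub>1 |\<union>| Dia |`| \<Gamma>\<^sub>2)]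
     (Box |`| \<Gamma>\<^sub>1 |\<union>| Neg |`| Dia |`| \<Gamma>\<^sub>2 \<Rrightarrow> finsert (\<box>\<alpha>) (Dia |`| \<Delta>\<^sub>1 |\<union>| Neg |`| Box |`| \<Delta>\<^sub>2))"
| "rule_inst DiaLT
     [finsert \<alpha> (Box |`| \<Gamma>\<^sub>1 |\<union>| Box |`| \<Delta>\<^sub>2) \<Rrightarrow> Dia |`| \<Delta>\<^sub>1 |\<union>| Dia |`| \<Gamma>\<^sub>2]
     (finsert (\<diamond>\<alpha>) (Box |`| \<Gamma>\<^sub>1 |\<union>| Neg |`| Dia |`| \<Gamma>\<^sub>2) \<Rrightarrow> Dia |`| \<Delta>\<^sub>1 |\<union>| Neg |`| Box |`| \<Delta>\<^sub>2)"
| "rule_inst NegBoxLT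
     [Box |`| \<Gamma>\<^sub>1 |\<union>| Box |`| \<Delta>\<^sub>2 \<Rrightarrow> finsert \<alpha> (Dia |`| \<Delta>\<^sub>1 |\<union>| Dia |`| \<Gamma>\<^sub>2)]
     (finsert (\<^bold>\<not>\<box>\<alpha>) (Box |`| \<Gamma>\<^sub>1 |\<union>| Neg |`| Dia |`| \<Gamma>\<^sub>2) \<Rrightarrow> Dia |`| \<Delta>\<^sub>1 |\<union>| Neg |`| Box |`| \<Delta>\<^sub>2)"
| "rule_inst NegDiaRT
     [finsert \<alpha> (Box |`| \<Gamma>\<^sub>1 |\<union>| Box |`| \<Delta>\<^sub>2) \<Rrightarrow> Dia |`| \<Delta>\<^sub>1 |\<union>| Dia |`| \<Gamma>\<^sub>2]
     (Box |`| \<Gamma>\<^sub>1 |\<union>| Neg |`| Dia |`| \<Gamma>\<^sub>2 \<Rrightarrow> finsert (\<^bold>\<not>\<diamond>\<alpha>) (Dia |`| \<Delta>\<^sub>1 |\<union>| Neg |`| Box |`| \<Delta>\<^sub>2))"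

definition lTS4 :: "rule_name set" where
  "lTS4 = UNIV - {BoxRT, DiaLT, NegBoxLT, NegDiaRT}"

definition gTS4 :: "rule_name set" where
  "gTS4 = (lTS4 - {BoxR, DiaL, NegBoxL, NegDiaR}) \<union> {BoxRT, DiaLT, NegBoxLT, NegDiaRT}"

definition cut_free :: "rule_name set \<Rightarrow> rule_name set" where
  "cut_free L = L - {Cut}"

inductive provable :: "rule_name set \<Rightarrow> sequent \<Rightarrow> bool" for M where
  initial: "initial S \<Longrightarrow> provable M S"
| rule: "r \<in> M \<Longrightarrow> rule_inst r Ps S \<Longrightarrow> \<forall>P \<in> set Ps. provable M P \<Longrightarrow> provable M S"

definition admissible :: "(sequent list \<Rightarrow> sequent \<Rightarrow> bool) \<Rightarrow> rule_name set \<Rightarrow> bool" where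
  "admissible R M \<longleftrightarrow>
     (\<forall>Ps S. R Ps S \<longrightarrow> (\<forall>P \<in> set Ps. provable M P) \<longrightarrow> provable M S)"

inductive neg_left_inv :: "sequent list \<Rightarrow> sequent \<Rightarrow> bool" where
  "neg_left_inv [\<Gamma> \<Rrightarrow> finsert (\<^bold>\<not>\<alpha>) \<Delta>] (finsert \<alpha> \<Gamma> \<Rrightarrow> \<Delta>)"

inductive neg_right_inv :: "sequent list \<Rightarrow> sequent \<Rightarrow> bool" where
  "neg_right_inv [finsert (\<^bold>\<not>\<alpha>) \<Gamma> \<Rrightarrow> \<Delta>] (\<Gamma> \<Rrightarrow> finsert \<alpha> \<Delta>)"

end

theory Submission
  imports Defs
begin

text \<open>
  Read a sequent as a set of signed formulas, the antecedent positive and the succedent negative,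
  and strip leading negations while flipping the sign; the premise and the conclusion of
  (\<open>\<not>\<close>left\<open>\<^sup>-\<^sup>1\<close>) and (\<open>\<not>\<close>right\<open>\<^sup>-\<^sup>1\<close>) have the same stripped set. So it suffices that cut-free
  provability depends only on the stripped set. On stripped sets a rule and its twist counterpart
  perform the same inference, and the modal rules of lTS4 and gTS4 agree, so derivations in both
  calculi project to one negation-free calculus of signed formulas. Conversely, a formula with
  stripped form \<open>\<sigma>\<close> is, up to double negations, either \<open>\<sigma>\<close> itself, and the non-twist rule performs
  the inference on it, or the negation of \<open>\<sigma>\<close> on the other side, and the twist rule does.
\<close>

type_synonym signed_fm = "bool \<times> fm"

fun strip_neg :: "signed_fm \<Rightarrow> signed_fm" where
  "strip_neg (b, \<^bold>\<not>\<alpha>) = strip_neg (\<not> b, \<alpha>)"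
| "strip_neg \<sigma> = \<sigma>"

fun cancel_neg_neg :: "signed_fm \<Rightarrow> signed_fm" where
  "cancel_neg_neg (b, \<^bold>\<not>\<^bold>\<not>\<alpha>) = cancel_neg_neg (b, \<alpha>)"
| "cancel_neg_neg \<sigma> = \<sigma>"

fun twist :: "signed_fm \<Rightarrow> signed_fm" where
  "twist (b, \<alpha>) = (\<not> b, \<^bold>\<not>\<alpha>)"

lemma strip_neg_twist [simp]: "strip_neg (twist \<sigma>) = strip_neg \<sigma>"
  by (cases \<sigma>) simp

lemma cancel_neg_neg_in_twist: "cancel_neg_neg \<sigma> \<in> {strip_neg \<sigma>, twist (strip_neg \<sigma>)}"
  by (induction \<sigma> rule: cancel_neg_neg.induct) auto

fun signed_fms :: "sequent \<Rightarrow> signed_fm set" where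
  "signed_fms (\<Gamma> \<Rrightarrow> \<Delta>) = Pair True ` fset \<Gamma> \<union> Pair False ` fset \<Delta>"

fun add_signed :: "signed_fm \<Rightarrow> sequent \<Rightarrow> sequent" where
  "add_signed (True, \<alpha>) (\<Gamma> \<Rrightarrow> \<Delta>) = (finsert \<alpha> \<Gamma> \<Rrightarrow> \<Delta>)"
| "add_signed (False, \<alpha>) (\<Gamma> \<Rrightarrow> \<Delta>) = (\<Gamma> \<Rrightarrow> finsert \<alpha> \<Delta>)"

definition stripped :: "sequent \<Rightarrow> signed_fm set" where
  "stripped S = strip_neg ` signed_fms S"

lemma finite_signed_fms: "finite (signed_fms S)"
  by (cases S) simp

lemma signed_fms_eqI: "signed_fms S = signed_fms T \<Longrightarrow> S = T"
  by (cases S; cases T) (auto simp: fset_eq_iff set_eq_iff image_iff)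

lemma signed_fms_add_signed [simp]: "signed_fms (add_signed \<sigma> S) = insert \<sigma> (signed_fms S)"
  by (cases "(\<sigma>, S)" rule: add_signed.cases) auto

lemma signed_fms_foldr_add_signed [simp]:
  "signed_fms (foldr add_signed \<sigma>s S) = set \<sigma>s \<union> signed_fms S"
  by (induction \<sigma>s) simp_all

lemma stripped_add_signed [simp]: "stripped (add_signed \<sigma> S) = insert (strip_neg \<sigma>) (stripped S)"
  by (simp add: stripped_def)

lemma stripped_foldr_add_signed:
  "stripped (foldr add_signed \<sigma>s S) = strip_neg ` set \<sigma>s \<union> stripped S"
  by (simp add: stripped_def image_Un)

lemma stripped_finsert:
  "stripped (finsert \<alpha> \<Gamma> \<Rrightarrow> \<Delta>) = insert (strip_neg (True, \<alpha>)) (stripped (\<Gamma> \<Rrightarrow> \<Delta>))"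
  "stripped (\<Gamma> \<Rrightarrow> finsert \<alpha> \<Delta>) = insert (strip_neg (False, \<alpha>)) (stripped (\<Gamma> \<Rrightarrow> \<Delta>))"
  by (simp_all flip: add_signed.simps)

lemma stripped_twistE:
  assumes "\<sigma> \<in> stripped S"
  obtains \<pi> where "\<pi> \<in> {\<sigma>, twist \<sigma>}" "\<pi> \<in> cancel_neg_neg ` signed_fms S"
  using assms cancel_neg_neg_in_twist unfolding stripped_def by (metis imageE imageI)

definition modal_sequent :: "fm fset \<Rightarrow> fm fset \<Rightarrow> fm fset \<Rightarrow> fm fset \<Rightarrow> sequent" where
  "modal_sequent \<Gamma>\<^sub>1 \<Gamma>\<^sub>2 \<Delta>\<^sub>1 \<Delta>\<^sub>2 =
    (Box |`| \<Gamma>\<^sub>1 |\<union>| Neg |`| Dia |`| \<Gamma>\<^sub>2 \<Rrightarrow> Dia |`| \<Delta>\<^sub>1 |\<union>| Neg |`| Box |`| \<Delta>\<^sub>2)"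

definition untwisted_modal_sequent :: "fm fset \<Rightarrow> fm fset \<Rightarrow> fm fset \<Rightarrow> fm fset \<Rightarrow> sequent" where
  "untwisted_modal_sequent \<Gamma>\<^sub>1 \<Gamma>\<^sub>2 \<Delta>\<^sub>1 \<Delta>\<^sub>2 =
    (Box |`| \<Gamma>\<^sub>1 |\<union>| Box |`| \<Delta>\<^sub>2 \<Rrightarrow> Dia |`| \<Delta>\<^sub>1 |\<union>| Dia |`| \<Gamma>\<^sub>2)"

definition persistent :: "signed_fm set" where
  "persistent = range (\<lambda>\<gamma>. (True, \<box>\<gamma>)) \<union> range (\<lambda>\<delta>. (False, \<diamond>\<delta>))"

lemma stripped_untwisted_modal_sequent:
  "stripped (untwisted_modal_sequent \<Gamma>\<^sub>1 \<Gamma>\<^sub>2 \<Delta>\<^sub>1 \<Delta>\<^sub>2) = stripped (modal_sequent \<Gamma>\<^sub>1 \<Gamma>\<^sub>2 \<Delta>\<^sub>1 \<Delta>\<^sub>2)"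
  by (auto simp: stripped_def modal_sequent_def untwisted_modal_sequent_def image_Un image_image)

lemma stripped_modal_sequent_subset_persistent:
  "stripped (modal_sequent \<Gamma>\<^sub>1 \<Gamma>\<^sub>2 \<Delta>\<^sub>1 \<Delta>\<^sub>2) \<subseteq> persistent"
  by (auto simp: stripped_def modal_sequent_def persistent_def)

lemma ex_fset_preimage:
  assumes "finite C" "inj f"
  shows "\<exists>A. \<forall>\<alpha>. \<alpha> |\<in>| A \<longleftrightarrow> f \<alpha> \<in> C"
  using finite_vimageI[OF assms] by (metis fset_cases mem_Collect_eq vimage_eq)

lemma ex_modal_sequent_signed_fms:
  assumes "finite C"
  shows "\<exists>\<Gamma>\<^sub>1 \<Gamma>\<^sub>2 \<Delta>\<^sub>1 \<Delta>\<^sub>2.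
    signed_fms (modal_sequent \<Gamma>\<^sub>1 \<Gamma>\<^sub>2 \<Delta>\<^sub>1 \<Delta>\<^sub>2) = C \<inter> (persistent \<union> twist ` persistent)"
proof -
  note preimage = ex_fset_preimage[OF assms]
  obtain \<Gamma>\<^sub>1 where \<Gamma>\<^sub>1: "\<And>\<alpha>. \<alpha> |\<in>| \<Gamma>\<^sub>1 \<longleftrightarrow> (True, \<box>\<alpha>) \<in> C"
    using preimage[of "\<lambda>\<alpha>. (True, \<box>\<alpha>)"] by (auto simp: inj_def)
  obtain \<Gamma>\<^sub>2 where \<Gamma>\<^sub>2: "\<And>\<alpha>. \<alpha> |\<in>| \<Gamma>\<^sub>2 \<longleftrightarrow> (True, \<^bold>\<not>\<diamond>\<alpha>) \<in> C"
    using preimage[of "\<lambda>\<alpha>. (True, \<^bold>\<not>\<diamond>\<alpha>)"] by (auto simp: inj_def)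
  obtain \<Delta>\<^sub>1 where \<Delta>\<^sub>1: "\<And>\<alpha>. \<alpha> |\<in>| \<Delta>\<^sub>1 \<longleftrightarrow> (False, \<diamond>\<alpha>) \<in> C"
    using preimage[of "\<lambda>\<alpha>. (False, \<diamond>\<alpha>)"] by (auto simp: inj_def)
  obtain \<Delta>\<^sub>2 where \<Delta>\<^sub>2: "\<And>\<alpha>. \<alpha> |\<in>| \<Delta>\<^sub>2 \<longleftrightarrow> (False, \<^bold>\<not>\<box>\<alpha>) \<in> C"
    using preimage[of "\<lambda>\<alpha>. (False, \<^bold>\<not>\<box>\<alpha>)"] by (auto simp: inj_def)
  have "signed_fms (modal_sequent \<Gamma>\<^sub>1 \<Gamma>\<^sub>2 \<Delta>\<^sub>1 \<Delta>\<^sub>2) = C \<inter> (persistent \<union> twist ` persistent)"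
    by (auto simp: modal_sequent_def persistent_def \<Gamma>\<^sub>1 \<Gamma>\<^sub>2 \<Delta>\<^sub>1 \<Delta>\<^sub>2 image_image image_Un)
  then show ?thesis
    by blast
qed

lemma covering_modal_sequentE:
  assumes "K \<subseteq> persistent" "K \<subseteq> stripped S"
  obtains \<Gamma>\<^sub>1 \<Gamma>\<^sub>2 \<Delta>\<^sub>1 \<Delta>\<^sub>2
    where "signed_fms (modal_sequent \<Gamma>\<^sub>1 \<Gamma>\<^sub>2 \<Delta>\<^sub>1 \<Delta>\<^sub>2) \<subseteq> cancel_neg_neg ` signed_fms S"
      and "K \<subseteq> stripped (modal_sequent \<Gamma>\<^sub>1 \<Gamma>\<^sub>2 \<Delta>\<^sub>1 \<Delta>\<^sub>2)"
proof -
  let ?C = "cancel_neg_neg ` signed_fms S"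
  obtain \<Gamma>\<^sub>1 \<Gamma>\<^sub>2 \<Delta>\<^sub>1 \<Delta>\<^sub>2 where signed:
    "signed_fms (modal_sequent \<Gamma>\<^sub>1 \<Gamma>\<^sub>2 \<Delta>\<^sub>1 \<Delta>\<^sub>2) = ?C \<inter> (persistent \<union> twist ` persistent)"
    using ex_modal_sequent_signed_fms finite_signed_fms by (metis finite_imageI)
  have "K \<subseteq> stripped (modal_sequent \<Gamma>\<^sub>1 \<Gamma>\<^sub>2 \<Delta>\<^sub>1 \<Delta>\<^sub>2)"
  proof
    fix \<kappa>
    assume "\<kappa> \<in> K"
    then obtain \<pi> where \<pi>: "\<pi> \<in> {\<kappa>, twist \<kappa>}" "\<pi> \<in> ?C"
      using assms(2) stripped_twistE by blast
    have "\<kappa> \<in> persistent"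
      using \<open>\<kappa> \<in> K\<close> assms(1) by blast
    then have "\<pi> \<in> signed_fms (modal_sequent \<Gamma>\<^sub>1 \<Gamma>\<^sub>2 \<Delta>\<^sub>1 \<Delta>\<^sub>2)"
      using \<pi> signed by auto
    moreover have "strip_neg \<pi> = \<kappa>"
      using \<pi>(1) \<open>\<kappa> \<in> persistent\<close> by (auto simp: persistent_def)
    ultimately show "\<kappa> \<in> stripped (modal_sequent \<Gamma>\<^sub>1 \<Gamma>\<^sub>2 \<Delta>\<^sub>1 \<Delta>\<^sub>2)"
      by (auto simp: stripped_def)
  qed
  then show thesis
    using that signed by blast
qed

inductive decomposes :: "signed_fm \<Rightarrow> signed_fm list list \<Rightarrow> bool" where
  "decomposes (True, \<alpha> \<^bold>\<and> \<beta>) [[(True, \<alpha>), (True, \<beta>)]]"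
| "decomposes (False, \<alpha> \<^bold>\<and> \<beta>) [[(False, \<alpha>)], [(False, \<beta>)]]"
| "decomposes (True, \<alpha> \<^bold>\<or> \<beta>) [[(True, \<alpha>)], [(True, \<beta>)]]"
| "decomposes (False, \<alpha> \<^bold>\<or> \<beta>) [[(False, \<alpha>), (False, \<beta>)]]"
| "decomposes (True, \<alpha> \<^bold>\<rightarrow> \<beta>) [[(False, \<alpha>)], [(True, \<beta>)]]"
| "decomposes (False, \<alpha> \<^bold>\<rightarrow> \<beta>) [[(True, \<alpha>), (False, \<beta>)]]"
| "decomposes (True, \<box>\<alpha>) [[(True, \<alpha>)]]"
| "decomposes (False, \<diamond>\<alpha>) [[(False, \<alpha>)]]"

inductive modal_step :: "signed_fm \<Rightarrow> signed_fm \<Rightarrow> bool" where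
  "modal_step (False, \<box>\<alpha>) (False, \<alpha>)"
| "modal_step (True, \<diamond>\<alpha>) (True, \<alpha>)"

inductive signed_derivable :: "signed_fm set \<Rightarrow> bool" where
  initial: "signed_derivable {(True, Var p), (False, Var p)}"
| weaken: "signed_derivable X \<Longrightarrow> X \<subseteq> Y \<Longrightarrow> signed_derivable Y"
| decompose: "decomposes \<sigma> Bs \<Longrightarrow> \<forall>B \<in> set Bs. signed_derivable (strip_neg ` set B \<union> X) \<Longrightarrow>
    signed_derivable (insert \<sigma> X)"
| modal: "modal_step \<sigma> \<tau> \<Longrightarrow> K \<subseteq> persistent \<Longrightarrow> signed_derivable (insert (strip_neg \<tau>) K) \<Longrightarrow>
    signed_derivable (insert \<sigma> K)"

lemmas signed_derivable_decompose = decomposes.intros[THEN signed_derivable.decompose, simplified]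

lemmas signed_derivable_modal =
  modal_step.intros[THEN signed_derivable.modal, OF stripped_modal_sequent_subset_persistent]

lemma signed_derivable_rule_inst:
  assumes "rule_inst r Ps S" "r \<noteq> Cut" "\<forall>P \<in> set Ps. signed_derivable (stripped P)"
  shows "signed_derivable (stripped S)"
  using assms
  by cases
    (auto simp: stripped_finsert stripped_untwisted_modal_sequent insert_commute
      intro: signed_derivable.weaken signed_derivable_decompose signed_derivable_modal
      simp flip: modal_sequent_def untwisted_modal_sequent_def simp del: fset.map_comp)

lemma provable_imp_signed_derivable:
  assumes "Cut \<notin> M" "provable M S"
  shows "signed_derivable (stripped S)"
  using assms(2)
proof induction
  case (initial S)
  then show ?case
    by cases (use signed_derivable.initial in \<open>auto simp: stripped_def insert_commute\<close>)
next
  case (rule r Ps S)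
  with assms(1) show ?case
    by (auto intro: signed_derivable_rule_inst)
qed

lemma provable_if_ex_rule_inst:
  assumes "\<exists>r \<in> R. rule_inst r Ps S" "R \<subseteq> M" "\<forall>P \<in> set Ps. provable M P"
  shows "provable M S"
  using assms provable.rule by blast

lemma decomposes_rule_inst:
  assumes "decomposes \<sigma> Bs" "\<pi> \<in> {\<sigma>, twist \<sigma>}"
  shows "\<exists>r \<in> cut_free lTS4 \<inter> cut_free gTS4.
    rule_inst r (map (\<lambda>B. foldr add_signed B S) Bs) (add_signed \<pi> S)"
  using assms
  by (cases S; cases rule: decomposes.cases)
    (auto, (rule bexI, rule rule_inst.intros, simp add: cut_free_def lTS4_def gTS4_def)+)

lemma modal_step_rule_inst_lTS4:
  assumes "modal_step \<sigma> \<tau>" "\<pi> \<in> {\<sigma>, twist \<sigma>}"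
  shows "\<exists>r \<in> cut_free lTS4. rule_inst r [add_signed \<tau> (modal_sequent \<Gamma>\<^sub>1 \<Gamma>\<^sub>2 \<Delta>\<^sub>1 \<Delta>\<^sub>2)]
    (add_signed \<pi> (modal_sequent \<Gamma>\<^sub>1 \<Gamma>\<^sub>2 \<Delta>\<^sub>1 \<Delta>\<^sub>2))"
  using assms
  by cases (auto simp: modal_sequent_def simp del: fset.map_comp,
      (rule bexI, rule rule_inst.intros, simp add: cut_free_def lTS4_def)+)

lemma modal_step_rule_inst_gTS4:
  assumes "modal_step \<sigma> \<tau>" "\<pi> \<in> {\<sigma>, twist \<sigma>}"
  shows "\<exists>r \<in> cut_free gTS4. rule_inst r [add_signed \<tau> (untwisted_modal_sequent \<Gamma>\<^sub>1 \<Gamma>\<^sub>2 \<Delta>\<^sub>1 \<Delta>\<^sub>2)]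
    (add_signed \<pi> (modal_sequent \<Gamma>\<^sub>1 \<Gamma>\<^sub>2 \<Delta>\<^sub>1 \<Delta>\<^sub>2))"
  using assms
  by cases (auto simp: modal_sequent_def untwisted_modal_sequent_def simp del: fset.map_comp,
      (rule bexI, rule rule_inst.intros, simp add: cut_free_def gTS4_def)+)

context
  fixes M :: "rule_name set"
  assumes cut_free_subset: "cut_free lTS4 \<subseteq> M \<or> cut_free gTS4 \<subseteq> M"
begin

lemma shared_rules_subset: "cut_free lTS4 \<inter> cut_free gTS4 \<subseteq> M"
  using cut_free_subset by blast

lemma provable_weaken:
  assumes "provable M S"
  shows "provable M (add_signed \<sigma> S)"
proof -
  have "\<exists>r \<in> cut_free lTS4 \<inter> cut_free gTS4. rule_inst r [S] (add_signed \<sigma> S)"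
    by (cases "(\<sigma>, S)" rule: add_signed.cases)
      (simp_all, (rule bexI, rule rule_inst.intros, simp add: cut_free_def lTS4_def gTS4_def)+)
  then show ?thesis
    by (rule provable_if_ex_rule_inst[OF _ shared_rules_subset]) (simp add: assms)
qed

lemma provable_add_signed_cancel_neg_neg:
  assumes "provable M (add_signed (cancel_neg_neg \<sigma>) S)"
  shows "provable M (add_signed \<sigma> S)"
  using assms
proof (induction \<sigma> rule: cancel_neg_neg.induct)
  case (1 b \<alpha>)
  have "\<exists>r \<in> cut_free lTS4 \<inter> cut_free gTS4.
      rule_inst r [add_signed (b, \<alpha>) S] (add_signed (b, \<^bold>\<not>\<^bold>\<not>\<alpha>) S)"
    by (cases S; cases b)
      (simp_all, (rule bexI, rule rule_inst.intros, simp add: cut_free_def lTS4_def gTS4_def)+)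
  then show ?case
    by (rule provable_if_ex_rule_inst[OF _ shared_rules_subset]) (use 1 in simp)
qed simp_all

lemma provable_weaken_list:
  "provable M S \<Longrightarrow> provable M (foldr add_signed \<sigma>s S)"
  by (induction \<sigma>s) (simp_all add: provable_weaken)

lemma add_signed_foldr_add_signed:
  "add_signed \<sigma> (foldr add_signed \<sigma>s S) = foldr add_signed \<sigma>s (add_signed \<sigma> S)"
  by (rule signed_fms_eqI) simp

lemma provable_foldr_add_signed_cancel_neg_neg:
  assumes "provable M (foldr add_signed (map cancel_neg_neg \<sigma>s) S)"
  shows "provable M (foldr add_signed \<sigma>s S)"
  using assms
proof (induction \<sigma>s arbitrary: S)
  case (Cons \<sigma> \<sigma>s)
  have "provable M (add_signed (cancel_neg_neg \<sigma>) (foldr add_signed (map cancel_neg_neg \<sigma>s) S))"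
    using Cons.prems by simp
  then have "provable M (foldr add_signed (map cancel_neg_neg \<sigma>s) (add_signed \<sigma> S))"
    unfolding add_signed_foldr_add_signed[symmetric] by (rule provable_add_signed_cancel_neg_neg)
  then have "provable M (foldr add_signed \<sigma>s (add_signed \<sigma> S))"
    by (rule Cons.IH)
  then show ?case
    by (simp add: add_signed_foldr_add_signed)
qed simp

lemma provable_mono_cancel_neg_neg:
  assumes "provable M T" "signed_fms T \<subseteq> signed_fms S \<union> cancel_neg_neg ` signed_fms S"
  shows "provable M S"
proof -
  obtain \<sigma>s where \<sigma>s: "set \<sigma>s = signed_fms S"
    using finite_list[OF finite_signed_fms] by blast
  have "provable M (foldr add_signed (\<sigma>s @ map cancel_neg_neg \<sigma>s) T)"
    using assms(1) by (rule provable_weaken_list)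
  also have "foldr add_signed (\<sigma>s @ map cancel_neg_neg \<sigma>s) T =
      foldr add_signed (map cancel_neg_neg \<sigma>s) S"
    by (rule signed_fms_eqI) (use assms(2) \<sigma>s in auto)
  finally have "provable M (foldr add_signed \<sigma>s S)"
    by (rule provable_foldr_add_signed_cancel_neg_neg)
  also have "foldr add_signed \<sigma>s S = S"
    by (rule signed_fms_eqI) (simp add: \<sigma>s)
  finally show ?thesis .
qed

lemma provable_decomposes:
  assumes "decomposes \<sigma> Bs" "\<forall>B \<in> set Bs. provable M (foldr add_signed B S)"
    and "\<sigma> \<in> stripped S"
  shows "provable M S"
proof -
  obtain \<pi> where \<pi>: "\<pi> \<in> {\<sigma>, twist \<sigma>}" "\<pi> \<in> cancel_neg_neg ` signed_fms S"
    using assms(3) by (rule stripped_twistE)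
  have "provable M (add_signed \<pi> S)"
    using decomposes_rule_inst[OF assms(1) \<pi>(1)] shared_rules_subset
    by (rule provable_if_ex_rule_inst) (simp add: assms(2))
  then show ?thesis
    by (rule provable_mono_cancel_neg_neg) (use \<pi>(2) in auto)
qed

lemma provable_add_signed_modal_sequent:
  assumes "modal_step \<sigma> \<tau>" "\<pi> \<in> {\<sigma>, twist \<sigma>}"
    and "provable M (add_signed \<tau> (modal_sequent \<Gamma>\<^sub>1 \<Gamma>\<^sub>2 \<Delta>\<^sub>1 \<Delta>\<^sub>2))"
    and "provable M (add_signed \<tau> (untwisted_modal_sequent \<Gamma>\<^sub>1 \<Gamma>\<^sub>2 \<Delta>\<^sub>1 \<Delta>\<^sub>2))"
  shows "provable M (add_signed \<pi> (modal_sequent \<Gamma>\<^sub>1 \<Gamma>\<^sub>2 \<Delta>\<^sub>1 \<Delta>\<^sub>2))"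
  using cut_free_subset
proof
  assume "cut_free lTS4 \<subseteq> M"
  with modal_step_rule_inst_lTS4[OF assms(1,2)] show ?thesis
    by (rule provable_if_ex_rule_inst) (simp add: assms(3))
next
  assume "cut_free gTS4 \<subseteq> M"
  with modal_step_rule_inst_gTS4[OF assms(1,2)] show ?thesis
    by (rule provable_if_ex_rule_inst) (simp add: assms(4))
qed

lemma provable_modal_step:
  assumes "modal_step \<sigma> \<tau>" "K \<subseteq> persistent" "\<sigma> \<in> stripped S" "K \<subseteq> stripped S"
    and "\<And>T. insert (strip_neg \<tau>) K \<subseteq> stripped T \<Longrightarrow> provable M T"
  shows "provable M S"
proof -
  obtain \<Gamma>\<^sub>1 \<Gamma>\<^sub>2 \<Delta>\<^sub>1 \<Delta>\<^sub>2
    where modal: "signed_fms (modal_sequent \<Gamma>\<^sub>1 \<Gamma>\<^sub>2 \<Delta>\<^sub>1 \<Delta>\<^sub>2) \<subseteq> cancel_neg_neg ` signed_fms S"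
      and K: "K \<subseteq> stripped (modal_sequent \<Gamma>\<^sub>1 \<Gamma>\<^sub>2 \<Delta>\<^sub>1 \<Delta>\<^sub>2)"
    using assms(2,4) by (rule covering_modal_sequentE)
  obtain \<pi> where \<pi>: "\<pi> \<in> {\<sigma>, twist \<sigma>}" "\<pi> \<in> cancel_neg_neg ` signed_fms S"
    using assms(3) by (rule stripped_twistE)
  have "provable M (add_signed \<pi> (modal_sequent \<Gamma>\<^sub>1 \<Gamma>\<^sub>2 \<Delta>\<^sub>1 \<Delta>\<^sub>2))"
    using assms(1) \<pi>(1)
    by (rule provable_add_signed_modal_sequent; intro assms(5))
      (use K in \<open>auto simp: stripped_untwisted_modal_sequent\<close>)
  then show ?thesis
    by (rule provable_mono_cancel_neg_neg) (use \<pi>(2) modal in auto)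
qed

lemma provable_complementary_Var:
  assumes "(True, Var p) \<in> stripped S" "(False, Var p) \<in> stripped S"
  shows "provable M S"
proof -
  obtain \<pi> where \<pi>: "\<pi> \<in> {(True, Var p), twist (True, Var p)}" "\<pi> \<in> cancel_neg_neg ` signed_fms S"
    using assms(1) by (rule stripped_twistE)
  obtain \<rho> where \<rho>: "\<rho> \<in> {(False, Var p), twist (False, Var p)}" "\<rho> \<in> cancel_neg_neg ` signed_fms S"
    using assms(2) by (rule stripped_twistE)
  have "initial (add_signed \<pi> (add_signed \<rho> ({||} \<Rrightarrow> {||})))"
    using \<pi>(1) \<rho>(1) initial.intros[of p] by (auto simp: finsert_commute)
  then have "provable M (add_signed \<pi> (add_signed \<rho> ({||} \<Rrightarrow> {||})))"
    by (rule provable.initial)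
  then show ?thesis
    by (rule provable_mono_cancel_neg_neg) (use \<pi>(2) \<rho>(2) in auto)
qed

lemma signed_derivable_imp_provable:
  assumes "signed_derivable X" "X \<subseteq> stripped S"
  shows "provable M S"
  using assms
proof (induction arbitrary: S)
  case (initial p)
  then show ?case
    by (auto intro: provable_complementary_Var)
next
  case (weaken X Y)
  then show ?case
    by blast
next
  case (decompose \<sigma> Bs X)
  have "strip_neg ` set B \<union> X \<subseteq> stripped (foldr add_signed B S)" for B
    using decompose.prems by (auto simp: stripped_foldr_add_signed)
  with decompose.IH have "\<forall>B \<in> set Bs. provable M (foldr add_signed B S)"
    by blast
  with decompose.hyps(1) show ?case
    by (rule provable_decomposes) (use decompose.prems in simp)
next
  case (modal \<sigma> \<tau> K)
  then show ?case
    by (auto intro: provable_modal_step[OF modal.hyps(1,2), of S])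
qed

end

theorem provable_cut_free_iff_signed_derivable:
  assumes "L = lTS4 \<or> L = gTS4"
  shows "provable (cut_free L) S \<longleftrightarrow> signed_derivable (stripped S)"
proof
  show "signed_derivable (stripped S)" if "provable (cut_free L) S"
    using that by (rule provable_imp_signed_derivable[rotated]) (simp add: cut_free_def)
  show "provable (cut_free L) S" if "signed_derivable (stripped S)"
    using that assms by (intro signed_derivable_imp_provable) auto
qed

theorem theorem4p2:
  fixes L :: "rule_name set"
  assumes "L = lTS4 \<or> L = gTS4"
  shows "admissible neg_left_inv (cut_free L) \<and> admissible neg_right_inv (cut_free L)"
proof -
  note [simp] = provable_cut_free_iff_signed_derivable[OF assms] stripped_finsert
  show ?thesis
    unfolding admissible_def by (auto elim!: neg_left_inv.cases neg_right_inv.cases)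
qed

end
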